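(* For every integer $n \geq 2$ and every non-integer real $\rho \in (0,n)$, the $\mathrm{SA}_+$-rank of $P_{n,\rho} := \{x \in [0,1]^n : \sum_{i=1}^n x_i \leq n-\rho\}$ is at most $n - \lceil \rho \rceil + 1$.
   Context: Notation. $[n] := \{1,\ldots,n\}$. For $P \subseteq [0,1]^n$, the integer hull is $P_I := \mathrm{conv}(P \cap \{0,1\}^n)$, and $K(P) := \{ (\lambda, \lambda x) \in \mathbb{R}^{n+1} : \lambda \geq 0,\ x \in P\}$ (the extra coordinate is indexed by $0$). Let $\mathcal{F} := \{0,1\}^n$. For $S \subseteq [n]$ and $t \in \{0,1\}$, let $S|_t := \{x \in \mathcal{F} : x_i = t \ \forall i \in S\}$ (so $\emptyset|_0=\emptyset|_1=\mathcal{F}$), and write $i|_t$ for $\{i\}|_t$. For an integer $\ell \ge 0$, let $\mathcal{A}_\ell := \{S|_1 \cap T|_0 : S,T \subseteq [n],\ S \cap T = \emptyset,\ |S|+|T| \leq \ell\}$. For a vector $y$ indexed by a family of subsets of $\mathcal{F}$ containing $\mathcal{F}$ and all $i|_1$, let $\hat{x}(y) := (y_{\mathcal{F}}, y_{1|_1}, \ldots, y_{n|_1})^\top$. For a matrix $Y$, $Y e_\alpha$ denotes its column indexed by $\alpha$. The operator $\mathrm{SA}_+^k$ ($k \geq 1$ an integer). Let $\widehat{\mathrm{SA}}_+^k(P)$ be the set of real symmetric positive semidefinite matrices $Y$ with rows and columns indexed by $\mathcal{A}_k$ such that: (1) $Y[\mathcal{F},\mathcal{F}] = 1$; (2) for every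 $\alpha \in \mathcal{A}_k$: $\hat{x}(Y e_\alpha) \in K(P)$ and $Y e_\alpha \geq 0$; (3) for every $S|_1 \cap T|_0 \in \mathcal{A}_{k-1}$ (with $S\cap T=\emptyset$, $|S|+|T|\le k-1$) and every $j \in [n]\setminus(S \cup T)$: $Y e_{S|_1 \cap T|_0 \cap j|_1} + Y e_{S|_1 \cap T|_0 \cap j|_0} = Y e_{S|_1 \cap T|_0}$; (4) for all $\alpha,\beta \in \mathcal{A}_k$ with $\alpha \cap \beta = \emptyset$: $Y[\alpha,\beta] = 0$; (5) for all $\alpha_1,\alpha_2,\beta_1,\beta_2 \in \mathcal{A}_k$ with $\alpha_1 \cap \beta_1 = \alpha_2 \cap \beta_2$: $Y[\alpha_1,\beta_1] = Y[\alpha_2,\beta_2]$. Then $\mathrm{SA}_+^k(P) := \{x \in \mathbb{R}^n : \exists\, Y \in \widehat{\mathrm{SA}}_+^k(P),\ \hat{x}(Y e_{\mathcal{F}}) = (1,x)^\top\}$, and $\mathrm{SA}_+^0(P) := P$. The $\mathrm{SA}_+$-rank of $P$ is the smallest integer $k \geq 0$ such that $\mathrm{SA}_+^k(P) = P_I$. *)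

theory Defs
  imports "HOL-Analysis.Analysis" "HOL-Library.Extended_Nat"
begin

text \<open>
  The ground set \<open>[n]\<close> is the finite index type \<^typ>\<open>'n\<close>, so that \<open>n\<close> is \<open>CARD('n)\<close>. A vector
  with entries indexed by \<open>0, 1, ..., n\<close> is a pair whose first component is the entry at \<open>0\<close>.
\<close>

definition cube01 :: "(real^'n) set" where
  "cube01 = {x. \<forall>i. x $ i = 0 \<or> x $ i = 1}"

definition integer_hull :: "(real^'n) set \<Rightarrow> (real^'n) set" where
  "integer_hull P = convex hull (P \<inter> cube01)"

definition homog_cone :: "(real^'n) set \<Rightarrow> (real \<times> (real^'n)) set" where
  "homog_cone P = {(l, l *\<^sub>R x) | l x. l \<ge> 0 \<and> x \<in> P}"

definition fix_to :: "'n set \<Rightarrow> real \<Rightarrow> (real^'n) set" where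
  "fix_to S t = {x \<in> cube01. \<forall>i\<in>S. x $ i = t}"

definition fam :: "nat \<Rightarrow> (real^'n) set set" where
  "fam l = {fix_to S 1 \<inter> fix_to T 0 | S T. S \<inter> T = {} \<and> card S + card T \<le> l}"

text \<open>
  Vectors and matrices indexed by a family \<open>I\<close> are total functions; every condition below constrains
  only the entries with indices in \<open>I\<close>, the other entries being irrelevant.
\<close>

definition xhat :: "((real^'n) set \<Rightarrow> real) \<Rightarrow> real \<times> (real^'n)" where
  "xhat y = (y cube01, \<chi> i. y (fix_to {i} 1))"

definition col :: "('a \<Rightarrow> 'a \<Rightarrow> real) \<Rightarrow> 'a \<Rightarrow> 'a \<Rightarrow> real" where
  "col Y \<alpha> = (\<lambda>\<beta>. Y \<beta> \<alpha>)"

definition symmetric_on :: "'a set \<Rightarrow> ('a \<Rightarrow> 'a \<Rightarrow> real) \<Rightarrow> bool" where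
  "symmetric_on I Y \<longleftrightarrow> (\<forall>\<alpha>\<in>I. \<forall>\<beta>\<in>I. Y \<alpha> \<beta> = Y \<beta> \<alpha>)"

definition psd_on :: "'a set \<Rightarrow> ('a \<Rightarrow> 'a \<Rightarrow> real) \<Rightarrow> bool" where
  "psd_on I Y \<longleftrightarrow>
     symmetric_on I Y \<and> (\<forall>v. 0 \<le> (\<Sum>\<alpha>\<in>I. \<Sum>\<beta>\<in>I. v \<alpha> * Y \<alpha> \<beta> * v \<beta>))"

text \<open>Only meaningful for \<open>k \<ge> 1\<close>.\<close>

definition SA_plus_mats ::
    "nat \<Rightarrow> (real^'n) set \<Rightarrow> ((real^'n) set \<Rightarrow> (real^'n) set \<Rightarrow> real) set" where
  "SA_plus_mats k P = {Y.
     psd_on (fam k) Y \<and>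
     Y cube01 cube01 = 1 \<and>
     (\<forall>\<alpha>\<in>fam k. xhat (col Y \<alpha>) \<in> homog_cone P \<and> (\<forall>\<beta>\<in>fam k. 0 \<le> col Y \<alpha> \<beta>)) \<and>
     (\<forall>S T j. S \<inter> T = {} \<longrightarrow> card S + card T \<le> k - 1 \<longrightarrow> j \<notin> S \<union> T \<longrightarrow>
        (\<forall>\<beta>\<in>fam k.
           col Y (fix_to S 1 \<inter> fix_to T 0 \<inter> fix_to {j} 1) \<beta> +
           col Y (fix_to S 1 \<inter> fix_to T 0 \<inter> fix_to {j} 0) \<beta> =
           col Y (fix_to S 1 \<inter> fix_to T 0) \<beta>)) \<and>
     (\<forall>\<alpha>\<in>fam k. \<forall>\<beta>\<in>fam k. \<alpha> \<inter> \<beta> = {} \<longrightarrow> Y \<alpha> \<beta> = 0) \<and>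
     (\<forall>\<alpha>1\<in>fam k. \<forall>\<alpha>2\<in>fam k. \<forall>\<beta>1\<in>fam k. \<forall>\<beta>2\<in>fam k.
        \<alpha>1 \<inter> \<beta>1 = \<alpha>2 \<inter> \<beta>2 \<longrightarrow> Y \<alpha>1 \<beta>1 = Y \<alpha>2 \<beta>2)}"

definition SA_plus :: "nat \<Rightarrow> (real^'n) set \<Rightarrow> (real^'n) set" where
  "SA_plus k P =
     (if k = 0 then P
      else {x. \<exists>Y\<in>SA_plus_mats k P. xhat (col Y cube01) = (1, x)})"

text \<open>
  The infimum in \<^typ>\<open>enat\<close> is the least such \<open>k\<close>, and \<open>\<infinity>\<close> if there is none; so a finite upper bound
  on the rank includes the assertion that the integer hull is reached.
\<close>

definition SA_plus_rank :: "(real^'n) set \<Rightarrow> enat" where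
  "SA_plus_rank P = Inf {enat k | k. SA_plus k P = integer_hull P}"

definition P_rho :: "real \<Rightarrow> (real^'n) set" where
  "P_rho \<rho> = {x. (\<forall>i. 0 \<le> x $ i \<and> x $ i \<le> 1) \<and> (\<Sum>i\<in>UNIV. x $ i) \<le> real CARD('n) - \<rho>}"

lemma SA_plus_rank_le_iff:
  "SA_plus_rank P \<le> enat m \<longleftrightarrow> (\<exists>k\<le>m. SA_plus k P = integer_hull P)"
proof
  assume le: "SA_plus_rank P \<le> enat m"
  let ?A = "{enat k | k. SA_plus k P = integer_hull P}"
  have "?A \<noteq> {}"
  proof
    assume "?A = {}"
    then have "SA_plus_rank P = \<infinity>"
      unfolding SA_plus_rank_def Inf_enat_def by (rule if_P)
    with le show False by simp
  qed
  then obtain a where "a \<in> ?A" by blast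
  then have "(LEAST x. x \<in> ?A) \<in> ?A" by (rule LeastI)
  with \<open>?A \<noteq> {}\<close> have "Inf ?A \<in> ?A"
    unfolding Inf_enat_def by (simp only: if_False)
  then show "\<exists>k\<le>m. SA_plus k P = integer_hull P"
    using le unfolding SA_plus_rank_def by auto
next
  assume "\<exists>k\<le>m. SA_plus k P = integer_hull P"
  then obtain k where "k \<le> m" "SA_plus k P = integer_hull P" by blast
  then have "SA_plus_rank P \<le> enat k"
    unfolding SA_plus_rank_def by (intro Inf_lower) blast
  with \<open>k \<le> m\<close> show "SA_plus_rank P \<le> enat m"
    by (meson enat_ord_simps(1) order_trans)
qed

end

theory Submission
  imports Defs
begin

text \<open>
  Let \<open>k = n - \<lceil>\<rho>\<rceil> + 1\<close>, the least integer larger than \<open>n - \<rho>\<close>. The \<open>0/1\<close> points of the sliced cube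
  are exactly those with fewer than \<open>k\<close> ones, and, more strongly, no fractional point of it has \<open>k\<close>
  coordinates equal to one. This is all that matters; for any convex \<open>P\<close> with these two
  properties the \<open>k\<close>-th relaxation is the integer hull (\<open>SA_plus_eq_integer_hull\<close>).

  The integer hull always lies in the relaxation: a convex combination of \<open>0/1\<close> points of \<open>P\<close> is
  the mean of a probability distribution on them, and \<open>Y[\<alpha>, \<beta>]\<close>, the probability of \<open>\<alpha> \<inter> \<beta>\<close>, is a
  certificate matrix.

  For the other inclusion, read a certificate \<open>Y\<close> as a table of pseudo-probabilities, and look at
  the face \<open>S|_1\<close> for a set \<open>S\<close> of \<open>k\<close> coordinates. The column of this face describes a multiple of
  a point of \<open>P\<close> whose coordinates in \<open>S\<close> are all one, so the multiple is zero: the diagonal entry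
  of \<open>S|_1\<close> vanishes (\<open>SA_plus_full_face_zero\<close>). By positive semidefiniteness its whole row vanishes,
  and by consistency so does every entry \<open>Y[S|_1, T|_1]\<close> with \<open>|S \<union> T| \<ge> k\<close>
  (\<open>SA_plus_large_union_zero\<close>). Consequently the pseudo-moments of fewer than \<open>k\<close> coordinates,
  extended by zero to all sets of coordinates, form a complete moment table, whose matrix
  \<open>(y (S \<union> T))\<close> over all pairs of sets is the block of \<open>Y\<close> on sets of size less than \<open>k\<close> bordered by
  zeros. Its Moebius transform gives a weight to each vertex of the cube, and the weight of a vertex
  is the value of the quadratic form at the multilinear polynomial that is the indicator function of
  that vertex. So the weights are nonnegative (\<open>superset_weight_moment_nonneg\<close>): they are a genuine
  probability distribution on the vertices with fewer than \<open>k\<close> ones, and \<open>x\<close> is its mean.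
\<close>

section \<open>Moebius inversion over supersets\<close>

lemma alternating_sum_interval:
  fixes U V :: "'n::finite set"
  assumes "U \<subseteq> V"
  shows "(\<Sum>W | U \<subseteq> W \<and> W \<subseteq> V. (-1::real) ^ card W) = (if U = V then (-1) ^ card U else 0)"
proof (cases "U = V")
  case True
  then have "{W. U \<subseteq> W \<and> W \<subseteq> V} = {V}" by auto
  with True show ?thesis by simp
next
  case False
  with assms have "U \<subset> V" by blast
  have "(\<Sum>W \<in> {W. U \<subseteq> W \<and> W \<subseteq> V}. (-1::real) ^ card W) = 0"
  proof (rule sum_alternating_cancels)
    show "card {W \<in> {W. U \<subseteq> W \<and> W \<subseteq> V}. even (card W)} = card {W \<in> {W. U \<subseteq> W \<and> W \<subseteq> V}. odd (card W)}"
      using card_subsupersets_even_odd[OF finite \<open>U \<subset> V\<close>] by (simp add: conj_ac)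
  qed simp
  with False show ?thesis by simp
qed

text \<open>
  The Moebius transform on the lattice of subsets. If \<open>y W\<close> is the probability that a random set
  contains \<open>W\<close>, this is the probability that it equals \<open>U\<close>.
\<close>

definition superset_weight :: "('n::finite set \<Rightarrow> real) \<Rightarrow> 'n set \<Rightarrow> real" where
  "superset_weight y U = (\<Sum>W | U \<subseteq> W. (-1) ^ (card U + card W) * y W)"

lemma sum_superset_weight:
  "(\<Sum>U | S \<subseteq> U. superset_weight y U) = y S"
proof -
  have "(\<Sum>U | S \<subseteq> U. superset_weight y U)
      = (\<Sum>U\<in>{U. S \<subseteq> U}. \<Sum>W | W \<in> UNIV \<and> U \<subseteq> W. (-1) ^ (card U + card W) * y W)"
    by (simp add: superset_weight_def)
  also have "\<dots> = (\<Sum>W\<in>UNIV. \<Sum>U | U \<in> {U. S \<subseteq> U} \<and> U \<subseteq> W. (-1) ^ (card U + card W) * y W)"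
    by (rule sum.swap_restrict) auto
  also have "\<dots> = (\<Sum>W\<in>UNIV. (-1) ^ card W * y W * (\<Sum>U | S \<subseteq> U \<and> U \<subseteq> W. (-1) ^ card U))"
    by (simp add: power_add sum_distrib_left mult_ac)
  also have "\<dots> = (\<Sum>W\<in>UNIV. if W = S then y W else 0)"
  proof (rule sum.cong[OF refl])
    fix W :: "'a set"
    show "(-1) ^ card W * y W * (\<Sum>U | S \<subseteq> U \<and> U \<subseteq> W. (-1) ^ card U) = (if W = S then y W else 0)"
    proof (cases "S \<subseteq> W")
      case True
      show ?thesis
        by (auto simp: alternating_sum_interval[OF True] simp flip: power_add)
    next
      case False
      then have "{U. S \<subseteq> U \<and> U \<subseteq> W} = {}" "W \<noteq> S" by auto
      then show ?thesis by (simp only: sum.empty) simp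
    qed
  qed
  finally show ?thesis by simp
qed

text \<open>
  The vector \<open>s U\<close> holds the coefficients of the multilinear polynomial
  \<open>(\<Prod>i\<in>U. x\<^sub>i) * (\<Prod>i\<in>-U. 1 - x\<^sub>i)\<close>, which is one at the vertex \<open>U\<close> of the cube and zero at the others.
  The quadratic form is the sum of the squared values of this polynomial at all vertices, weighted
  by \<open>superset_weight y\<close>; only the vertex \<open>U\<close> contributes.
\<close>

lemma superset_weight_quadratic_form:
  fixes y :: "'n::finite set \<Rightarrow> real"
  defines "s U W \<equiv> (if U \<subseteq> W then (-1) ^ (card U + card W) else 0)"
  shows "(\<Sum>W\<in>UNIV. \<Sum>W'\<in>UNIV. s U W * y (W \<union> W') * s U W') = superset_weight y U"
proof -
  let ?z = "superset_weight y"
  \<comment> \<open>The left-hand side is the value of the polynomial at the vertex \<open>V\<close>.\<close>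
  have key: "(\<Sum>W\<in>UNIV. if W \<subseteq> V then s U W else 0) = (if U = V then 1 else 0)" for V
  proof (cases "U \<subseteq> V")
    case True
    have "(\<Sum>W\<in>UNIV. if W \<subseteq> V then s U W else 0)
        = (\<Sum>W | U \<subseteq> W \<and> W \<subseteq> V. (-1) ^ (card U + card W))"
      unfolding s_def by (rule sum.mono_neutral_cong_right) auto
    also have "\<dots> = (-1) ^ card U * (\<Sum>W | U \<subseteq> W \<and> W \<subseteq> V. (-1) ^ card W)"
      by (simp add: power_add sum_distrib_left)
    also have "\<dots> = (if U = V then 1 else 0)"
      by (simp add: alternating_sum_interval[OF True] flip: power_add)
    finally show ?thesis .
  next
    case False
    then show ?thesis unfolding s_def by (intro sum.neutral[THEN trans]) auto
  qed
  have "y (W \<union> W') = (\<Sum>V\<in>UNIV. if W \<subseteq> V \<and> W' \<subseteq> V then ?z V else 0)" for W W'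
    unfolding sum_superset_weight[of y "W \<union> W'", symmetric]
    by (rule sum.mono_neutral_cong_left) auto
  then have "s U W * y (W \<union> W') * s U W'
      = (\<Sum>V\<in>UNIV. ?z V * ((if W \<subseteq> V then s U W else 0) * (if W' \<subseteq> V then s U W' else 0)))" for W W'
    by (simp only: sum_distrib_left sum_distrib_right) (auto intro!: sum.cong)
  then have "(\<Sum>W\<in>UNIV. \<Sum>W'\<in>UNIV. s U W * y (W \<union> W') * s U W')
     = (\<Sum>W\<in>UNIV. \<Sum>W'\<in>UNIV. \<Sum>V\<in>UNIV. ?z V * ((if W \<subseteq> V then s U W else 0) * (if W' \<subseteq> V then s U W' else 0)))"
    by simp
  also have "\<dots> = (\<Sum>W\<in>UNIV. \<Sum>V\<in>UNIV. \<Sum>W'\<in>UNIV. ?z V * ((if W \<subseteq> V then s U W else 0) * (if W' \<subseteq> V then s U W' else 0)))"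
    by (subst sum.swap) (rule refl)
  also have "\<dots> = (\<Sum>V\<in>UNIV. \<Sum>W\<in>UNIV. \<Sum>W'\<in>UNIV. ?z V * ((if W \<subseteq> V then s U W else 0) * (if W' \<subseteq> V then s U W' else 0)))"
    by (rule sum.swap)
  also have "\<dots> = (\<Sum>V\<in>UNIV. ?z V * ((\<Sum>W\<in>UNIV. if W \<subseteq> V then s U W else 0) * (\<Sum>W'\<in>UNIV. if W' \<subseteq> V then s U W' else 0)))"
    by (simp only: sum_product) (simp only: sum_distrib_left)
  also have "\<dots> = (\<Sum>V\<in>UNIV. if U = V then ?z V else 0)"
    unfolding key by (rule sum.cong) auto
  finally show ?thesis by simp
qed

section \<open>Faces of the cube\<close>

definition ind :: "'n set \<Rightarrow> real^'n" where
  "ind U = (\<chi> i. if i \<in> U then 1 else 0)"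

lemma ind_in_cube: "ind U \<in> cube01"
  by (simp add: ind_def cube01_def)

lemma finite_cube01: "finite (cube01 :: (real^'n::finite) set)"
proof (rule finite_subset)
  show "cube01 \<subseteq> range (ind :: 'n set \<Rightarrow> real^'n)"
  proof
    fix x :: "real^'n" assume "x \<in> cube01"
    then have "x = ind {i. x $ i = 1}"
      by (auto simp: cube01_def ind_def vec_eq_iff)
    then show "x \<in> range ind" by blast
  qed
qed simp

abbreviation ones :: "'n set \<Rightarrow> (real^'n) set" where
  "ones S \<equiv> fix_to S 1"

lemma ones_empty [simp]: "ones {} = cube01"
  by (simp add: fix_to_def)

lemma fam_subset_cube: "\<alpha> \<in> fam k \<Longrightarrow> \<alpha> \<subseteq> cube01"
  by (auto simp: fam_def fix_to_def)

lemma finite_fam: "finite (fam k :: (real^'n::finite) set set)"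
  by (rule finite_subset[of _ "Pow cube01"]) (auto dest: fam_subset_cube simp: finite_cube01)

lemma ones_in_fam: "card S \<le> k \<Longrightarrow> ones S \<in> fam k"
  unfolding fam_def by (rule CollectI, rule exI[of _ S], rule exI[of _ "{}"]) (auto simp: fix_to_def)

lemma ones_Int: "ones S \<inter> ones T = ones (S \<union> T)"
  by (auto simp: fix_to_def)

lemma ind_in_ones: "ind U \<in> ones S \<longleftrightarrow> S \<subseteq> U"
  by (auto simp: fix_to_def ind_in_cube) (auto simp: ind_def split: if_splits)

lemma inj_ones: "inj ones"
  by (rule injI) (metis ind_in_ones subset_antisym subset_refl)

section \<open>Validity of the relaxation\<close>

text \<open>
  The matrix is the nonnegative combination of the rank-one matrices \<open>w\<^sub>p w\<^sub>p\<^sup>T\<close>, where \<open>w\<^sub>p\<close> tells which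
  index sets contain \<open>p\<close>.
\<close>

lemma psd_on_finite_mixture:
  assumes "finite I" "finite Q" "\<And>p. p \<in> Q \<Longrightarrow> 0 \<le> u p"
  shows "psd_on I (\<lambda>\<alpha> \<beta>. \<Sum>p\<in>Q. if p \<in> \<alpha> \<inter> \<beta> then u p else 0)"
  unfolding psd_on_def symmetric_on_def
proof (intro conjI ballI allI)
  fix v :: "'a set \<Rightarrow> real"
  have "(\<Sum>\<alpha>\<in>I. \<Sum>\<beta>\<in>I. v \<alpha> * (\<Sum>p\<in>Q. if p \<in> \<alpha> \<inter> \<beta> then u p else 0) * v \<beta>)
      = (\<Sum>\<alpha>\<in>I. \<Sum>\<beta>\<in>I. \<Sum>p\<in>Q. u p * ((if p \<in> \<alpha> then v \<alpha> else 0) * (if p \<in> \<beta> then v \<beta> else 0)))"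
    by (simp only: sum_distrib_left sum_distrib_right) (auto intro!: sum.cong)
  also have "\<dots> = (\<Sum>\<alpha>\<in>I. \<Sum>p\<in>Q. \<Sum>\<beta>\<in>I. u p * ((if p \<in> \<alpha> then v \<alpha> else 0) * (if p \<in> \<beta> then v \<beta> else 0)))"
    by (subst sum.swap) (rule refl)
  also have "\<dots> = (\<Sum>p\<in>Q. \<Sum>\<alpha>\<in>I. \<Sum>\<beta>\<in>I. u p * ((if p \<in> \<alpha> then v \<alpha> else 0) * (if p \<in> \<beta> then v \<beta> else 0)))"
    by (rule sum.swap)
  also have "\<dots> = (\<Sum>p\<in>Q. u p * (\<Sum>\<alpha>\<in>I. if p \<in> \<alpha> then v \<alpha> else 0)\<^sup>2)"
    by (simp only: power2_eq_square sum_product) (simp only: sum_distrib_left)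
  also have "\<dots> \<ge> 0" by (intro sum_nonneg mult_nonneg_nonneg assms) auto
  finally show "0 \<le> (\<Sum>\<alpha>\<in>I. \<Sum>\<beta>\<in>I. v \<alpha> * (\<Sum>p\<in>Q. if p \<in> \<alpha> \<inter> \<beta> then u p else 0) * v \<beta>)" .
qed (simp add: Int_commute)

text \<open>
  Normalising the weights gives a convex combination of points of \<open>P\<close>. Weights that are all zero
  give the apex of the cone, which needs a point of \<open>P\<close>.
\<close>

lemma mixture_in_homog_cone:
  assumes "convex P" "P \<noteq> {}" "finite Q" "Q \<subseteq> P" "\<And>p. p \<in> Q \<Longrightarrow> 0 \<le> w p"
  shows "(sum w Q, \<Sum>p\<in>Q. w p *\<^sub>R p) \<in> homog_cone P"
proof (cases "sum w Q = 0")
  case True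
  with assms have "\<forall>p\<in>Q. w p = 0" by (simp add: sum_nonneg_eq_0_iff)
  moreover obtain q where "q \<in> P" using assms by blast
  ultimately show ?thesis unfolding homog_cone_def by auto
next
  case False
  moreover have "sum w Q \<ge> 0" using assms by (intro sum_nonneg)
  ultimately have pos: "sum w Q > 0" by simp
  let ?x = "\<Sum>p\<in>Q. (w p / sum w Q) *\<^sub>R p"
  have "?x \<in> P"
    using assms pos by (intro convex_sum) (auto simp flip: sum_divide_distrib)
  moreover have "(\<Sum>p\<in>Q. w p *\<^sub>R p) = sum w Q *\<^sub>R ?x"
    using pos by (simp add: scaleR_sum_right)
  ultimately show ?thesis using pos unfolding homog_cone_def by auto
qed

text \<open>
  The certificate is consistent because its entries are a function \<open>g\<close> of \<open>\<alpha> \<inter> \<beta>\<close>, and it is additive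
  because \<open>g\<close> is a measure on the \<open>0/1\<close> points of \<open>P\<close>. The column of \<open>\<alpha>\<close> describes the part of the
  combination that lies in \<open>\<alpha>\<close>.
\<close>

lemma integer_hull_subset_SA_plus:
  fixes P :: "(real^'n::finite) set"
  assumes "convex P"
  shows "integer_hull P \<subseteq> SA_plus k P"
proof
  fix x assume x: "x \<in> integer_hull P"
  let ?Q = "P \<inter> cube01"
  have fin: "finite ?Q" using finite_cube01 by blast
  from x obtain u where u: "\<And>p. p \<in> ?Q \<Longrightarrow> 0 \<le> u p" "sum u ?Q = 1"
    and xu: "x = (\<Sum>p\<in>?Q. u p *\<^sub>R p)"
    unfolding integer_hull_def convex_hull_finite[OF fin] by blast
  have ne: "P \<noteq> {}" using u(2) by auto
  have "x \<in> P"
    unfolding xu using assms u fin by (intro convex_sum) auto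
  define g where "g A = (\<Sum>p\<in>?Q. if p \<in> A then u p else 0)" for A
  define Y where "Y \<alpha> \<beta> = g (\<alpha> \<inter> \<beta>)" for \<alpha> \<beta>
  have g_nonneg: "g A \<ge> 0" for A
    unfolding g_def using u by (intro sum_nonneg) auto
  have g_cube: "g (cube01 \<inter> A) = g A" "g (A \<inter> cube01) = g A" for A
    unfolding g_def by (auto intro!: sum.cong)
  have xh: "xhat (col Y \<alpha>) = (g \<alpha>, \<Sum>p\<in>?Q. (if p \<in> \<alpha> then u p else 0) *\<^sub>R p)" for \<alpha>
  proof -
    have "g (ones {i} \<inter> \<alpha>) = (\<Sum>p\<in>?Q. (if p \<in> \<alpha> then u p else 0) *\<^sub>R p) $ i" for i
    proof -
      have "(if p \<in> ones {i} \<inter> \<alpha> then u p else 0) = (if p \<in> \<alpha> then u p else 0) * p $ i"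
        if "p \<in> ?Q" for p
      proof -
        from that have "p $ i = 0 \<or> p $ i = 1" by (auto simp: cube01_def)
        then show ?thesis using that by (auto simp: fix_to_def)
      qed
      then show ?thesis unfolding g_def sum_component vector_scaleR_component real_scaleR_def
        by (intro sum.cong refl)
    qed
    then show ?thesis by (simp add: xhat_def col_def Y_def g_cube vec_eq_iff)
  qed
  have "Y \<in> SA_plus_mats k P"
    unfolding SA_plus_mats_def mem_Collect_eq
  proof (intro conjI ballI allI impI)
    show "psd_on (fam k) Y"
      using psd_on_finite_mixture[OF finite_fam fin u(1)] unfolding Y_def g_def .
    show "Y cube01 cube01 = 1"
      unfolding Y_def g_cube u(2)[symmetric] g_def by (rule sum.cong) auto
    show "xhat (col Y \<alpha>) \<in> homog_cone P" for \<alpha>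
      unfolding xh g_def using assms ne fin u by (intro mixture_in_homog_cone) auto
    show "0 \<le> col Y \<alpha> \<beta>" for \<alpha> \<beta>
      by (simp add: col_def Y_def g_nonneg)
    show "col Y (ones S \<inter> fix_to T 0 \<inter> ones {j}) \<beta> + col Y (ones S \<inter> fix_to T 0 \<inter> fix_to {j} 0) \<beta>
        = col Y (ones S \<inter> fix_to T 0) \<beta>" for S T j \<beta>
      unfolding col_def Y_def g_def sum.distrib[symmetric]
      by (rule sum.cong) (auto simp: fix_to_def cube01_def)
    show "Y \<alpha> \<beta> = 0" if "\<alpha> \<inter> \<beta> = {}" for \<alpha> \<beta>
      by (simp add: Y_def that g_def)
    show "Y \<alpha>1 \<beta>1 = Y \<alpha>2 \<beta>2" if "\<alpha>1 \<inter> \<beta>1 = \<alpha>2 \<inter> \<beta>2" for \<alpha>1 \<alpha>2 \<beta>1 \<beta>2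
      by (simp add: Y_def that)
  qed
  moreover have "xhat (col Y cube01) = (1, x)"
    unfolding xh xu u(2)[symmetric] g_def by (auto intro!: sum.cong)
  ultimately show "x \<in> SA_plus k P"
    using \<open>x \<in> P\<close> by (auto simp: SA_plus_def)
qed

section \<open>Exactness of the relaxation\<close>

text \<open>
  On the vectors supported on \<open>\<alpha>\<close> and \<open>\<beta>\<close> with entries \<open>t\<close> and \<open>1\<close>, a form with \<open>Y[\<alpha>, \<alpha>] = 0\<close> is an
  affine function of \<open>t\<close> with slope \<open>2 * Y[\<alpha>, \<beta>]\<close>, so this slope must be zero.
\<close>

lemma psd_on_zero_diagonal:
  assumes "finite I" "psd_on I Y" "\<alpha> \<in> I" "\<beta> \<in> I" "Y \<alpha> \<alpha> = 0"
  shows "Y \<alpha> \<beta> = 0"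
proof (cases "\<alpha> = \<beta>")
  case False
  have sym: "Y \<beta> \<alpha> = Y \<alpha> \<beta>"
    using assms by (auto simp: psd_on_def symmetric_on_def)
  have nn: "0 \<le> 2 * t * Y \<alpha> \<beta> + Y \<beta> \<beta>" for t
  proof -
    let ?v = "\<lambda>\<gamma>. if \<gamma> = \<alpha> then t else if \<gamma> = \<beta> then 1 else 0"
    have red: "(\<Sum>\<gamma>\<in>I. f \<gamma>) = f \<alpha> + f \<beta>" if "\<And>\<gamma>. \<gamma> \<noteq> \<alpha> \<Longrightarrow> \<gamma> \<noteq> \<beta> \<Longrightarrow> f \<gamma> = 0" for f :: "_ \<Rightarrow> real"
    proof -
      have "(\<Sum>\<gamma>\<in>I. f \<gamma>) = (\<Sum>\<gamma>\<in>{\<alpha>,\<beta>}. f \<gamma>)"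
        using assms that by (intro sum.mono_neutral_right) auto
      then show ?thesis using False by simp
    qed
    have "0 \<le> (\<Sum>\<gamma>\<in>I. \<Sum>\<delta>\<in>I. ?v \<gamma> * Y \<gamma> \<delta> * ?v \<delta>)"
      using assms(2) by (auto simp: psd_on_def)
    also have "\<dots> = (\<Sum>\<gamma>\<in>I. ?v \<gamma> * Y \<gamma> \<alpha> * ?v \<alpha> + ?v \<gamma> * Y \<gamma> \<beta> * ?v \<beta>)"
      by (intro sum.cong refl red) auto
    also have "\<dots> = 2 * t * Y \<alpha> \<beta> + Y \<beta> \<beta>"
      using False assms(5) by (subst red) (auto simp: sym)
    finally show ?thesis .
  qed
  show ?thesis
  proof (rule ccontr)
    assume "Y \<alpha> \<beta> \<noteq> 0"
    with nn[of "- (Y \<beta> \<beta> + 1) / (2 * Y \<alpha> \<beta>)"] show False by (simp add: field_simps)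
  qed
qed (use assms in simp)

context
  fixes P :: "(real^'n::finite) set" and k :: nat and Y
  assumes Y: "Y \<in> SA_plus_mats k P"
    and few: "\<And>x. x \<in> P \<Longrightarrow> card {i. x $ i = 1} < k"
begin

lemma SA_plus_psd: "psd_on (fam k) Y"
  using Y by (simp add: SA_plus_mats_def)

lemma SA_plus_ones_eq:
  assumes "S \<union> T = S' \<union> T'" "card S \<le> k" "card T \<le> k" "card S' \<le> k" "card T' \<le> k"
  shows "Y (ones S) (ones T) = Y (ones S') (ones T')"
proof -
  have "ones S \<inter> ones T = ones S' \<inter> ones T'" using assms(1) by (simp add: ones_Int)
  then show ?thesis
    using Y ones_in_fam[OF assms(2)] ones_in_fam[OF assms(3)]
      ones_in_fam[OF assms(4)] ones_in_fam[OF assms(5)]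
    unfolding SA_plus_mats_def mem_Collect_eq by blast
qed

lemma k_pos: "k > 0" if "P \<noteq> {}"
  using that few by fastforce

text \<open>
  If the entry were nonzero, dividing the column of the face by it would give a point of \<open>P\<close> with
  ones in all the \<open>k\<close> coordinates of \<open>S\<close>.
\<close>

lemma SA_plus_full_face_zero:
  assumes "card S = k"
  shows "Y (ones S) (ones S) = 0"
proof (rule ccontr)
  assume nz: "Y (ones S) (ones S) \<noteq> 0"
  have "xhat (col Y (ones S)) \<in> homog_cone P"
    using Y ones_in_fam[of S k] assms by (simp add: SA_plus_mats_def)
  then obtain l x where lx: "xhat (col Y (ones S)) = (l, l *\<^sub>R x)" "x \<in> P"
    by (auto simp: homog_cone_def)
  have k: "k > 0" using lx(2) k_pos by blast
  have l: "Y cube01 (ones S) = l"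
    using lx(1) by (simp add: xhat_def col_def)
  have lS: "Y (ones S) (ones S) = l"
    using SA_plus_ones_eq[of S S "{}" S] assms l by simp
  have "x $ i = 1" if "i \<in> S" for i
  proof -
    have "l * x $ i = Y (ones {i}) (ones S)"
      using lx(1) by (simp add: xhat_def col_def vec_eq_iff)
    also have "\<dots> = Y (ones S) (ones S)"
      using that assms k by (intro SA_plus_ones_eq) auto
    finally show ?thesis using lS nz by simp
  qed
  then have "S \<subseteq> {i. x $ i = 1}" by auto
  then have "k \<le> card {i. x $ i = 1}"
    using assms card_mono[OF finite] by metis
  with few[OF lx(2)] show False by simp
qed

text \<open>
  The entry depends only on \<open>S \<union> T\<close>, so this union can be redistributed with exactly \<open>k\<close> of its
  elements on one side. The entry then lies in a row with zero diagonal.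
\<close>

lemma SA_plus_large_union_zero:
  assumes "card S \<le> k" "card T \<le> k" "k \<le> card (S \<union> T)"
  shows "Y (ones S) (ones T) = 0"
proof -
  obtain A where A: "A \<subseteq> S \<union> T" "card A = k"
    using obtain_subset_with_card_n[OF assms(3)] by metis
  have "card (S \<union> T) \<le> card S + card T" by (rule card_Un_le)
  then have B: "card (S \<union> T - A) \<le> k"
    using A assms by (simp add: card_Diff_subset)
  have "Y (ones S) (ones T) = Y (ones A) (ones (S \<union> T - A))"
    using A B assms by (intro SA_plus_ones_eq) auto
  also have "\<dots> = 0"
    using A(2) B
    by (simp add: psd_on_zero_diagonal[OF finite_fam SA_plus_psd] ones_in_fam SA_plus_full_face_zero)
  finally show ?thesis .
qed

text \<open>
  The cut-off makes the table total: \<open>Y\<close> gives no meaning to the moment of a set with more than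
  \<open>2 * k\<close> elements, and by the preceding lemma zero is the value forced on those in between.
\<close>

definition moment :: "'n set \<Rightarrow> real" where
  "moment S = (if card S < k then Y cube01 (ones S) else 0)"

lemma moment_zero_superset: "k \<le> card S \<Longrightarrow> S \<subseteq> T \<Longrightarrow> moment T = 0"
  using card_mono[of T S] by (simp add: moment_def)

lemma moment_matrix:
  assumes "card S < k" "card T < k"
  shows "moment (S \<union> T) = Y (ones S) (ones T)"
proof (cases "card (S \<union> T) < k")
  case True
  then show ?thesis
    using SA_plus_ones_eq[of "{}" "S \<union> T" S T] assms by (simp add: moment_def)
next
  case False
  then show ?thesis
    using SA_plus_large_union_zero[of S T] assms by (simp add: moment_def)
qed

text \<open>
  The weight is a value of the quadratic form of the complete moment matrix. Rows and columns of
  sets with at least \<open>k\<close> elements vanish, so it is also a value of the quadratic form of \<open>Y\<close>, at the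
  vector \<open>v\<close> that is \<open>s\<close> transported along the injection \<open>ones\<close> and extended by zero.
\<close>

lemma superset_weight_moment_nonneg: "superset_weight moment U \<ge> 0"
proof -
  define s where "s W = (if U \<subseteq> W then (-1) ^ (card U + card W) else 0 :: real)" for W
  define D where "D = {W :: 'n set. card W < k}"
  define v where "v \<alpha> = (\<Sum>W\<in>D. if \<alpha> = ones W then s W else 0)" for \<alpha>
  have v_ones: "v (ones W) = s W" if "W \<in> D" for W
  proof -
    have "v (ones W) = (\<Sum>W'\<in>D. if W = W' then s W' else 0)"
      unfolding v_def by (simp add: inj_eq[OF inj_ones])
    then show ?thesis using that by simp
  qed
  have v_zero: "v \<alpha> = 0" if "\<alpha> \<notin> ones ` D" for \<alpha>
    unfolding v_def using that by (intro sum.neutral) auto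
  have sub: "ones ` D \<subseteq> fam k"
    by (auto simp: D_def intro: ones_in_fam)
  have red: "(\<Sum>\<alpha>\<in>fam k. f \<alpha>) = (\<Sum>W\<in>D. f (ones W))" if "\<And>\<alpha>. \<alpha> \<notin> ones ` D \<Longrightarrow> f \<alpha> = 0" for f :: "_ \<Rightarrow> real"
  proof -
    have "(\<Sum>\<alpha>\<in>fam k. f \<alpha>) = (\<Sum>\<alpha>\<in>ones ` D. f \<alpha>)"
      using sub that by (intro sum.mono_neutral_right finite_fam) auto
    also have "\<dots> = (\<Sum>W\<in>D. f (ones W))"
      by (rule sum.reindex_cong[OF inj_on_subset[OF inj_ones]]) auto
    finally show ?thesis .
  qed
  have "0 \<le> (\<Sum>\<alpha>\<in>fam k. \<Sum>\<beta>\<in>fam k. v \<alpha> * Y \<alpha> \<beta> * v \<beta>)"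
    using SA_plus_psd by (simp add: psd_on_def)
  also have "\<dots> = (\<Sum>W\<in>D. \<Sum>\<beta>\<in>fam k. v (ones W) * Y (ones W) \<beta> * v \<beta>)"
    by (rule red) (simp add: v_zero)
  also have "\<dots> = (\<Sum>W\<in>D. \<Sum>W'\<in>D. v (ones W) * Y (ones W) (ones W') * v (ones W'))"
    by (intro sum.cong refl red) (simp add: v_zero)
  also have "\<dots> = (\<Sum>W\<in>D. \<Sum>W'\<in>D. s W * moment (W \<union> W') * s W')"
    by (intro sum.cong refl) (simp add: v_ones moment_matrix D_def)
  also have "\<dots> = (\<Sum>W\<in>D. \<Sum>W'\<in>UNIV. s W * moment (W \<union> W') * s W')"
    by (intro sum.cong refl sum.mono_neutral_left)
      (auto simp: D_def not_less intro: moment_zero_superset)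
  also have "\<dots> = (\<Sum>W\<in>UNIV. \<Sum>W'\<in>UNIV. s W * moment (W \<union> W') * s W')"
    by (intro sum.mono_neutral_left ballI sum.neutral)
      (auto simp: D_def not_less intro: moment_zero_superset)
  also have "\<dots> = superset_weight moment U"
    unfolding s_def by (rule superset_weight_quadratic_form)
  finally show ?thesis .
qed

lemma superset_weight_moment_large:
  assumes "k \<le> card U"
  shows "superset_weight moment U = 0"
  unfolding superset_weight_def
  by (rule sum.neutral) (simp add: moment_zero_superset[OF assms])

text \<open>
  Inverting the Moebius transform at the empty set and at the singletons shows that the weights sum
  to one and have mean \<open>x\<close>.
\<close>

lemma SA_plus_point_in_hull:
  assumes x: "xhat (col Y cube01) = (1, x)" and all: "\<And>U. card U < k \<Longrightarrow> ind U \<in> P"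
  shows "x \<in> integer_hull P"
proof -
  let ?z = "superset_weight moment"
  have Ymat: "Y cube01 cube01 = 1" using x by (simp add: xhat_def col_def)
  have x_i: "x $ i = Y (ones {i}) cube01" for i
    using x by (auto simp: xhat_def col_def)
  have "(cube01 :: (real^'n) set) \<in> fam k" using ones_in_fam[of "{}" k] by simp
  then have "xhat (col Y cube01) \<in> homog_cone P"
    using Y by (simp add: SA_plus_mats_def)
  then have "P \<noteq> {}" by (auto simp: homog_cone_def)
  then have k: "k > 0" by (rule k_pos)
  have one: "(\<Sum>U\<in>UNIV. ?z U) = 1"
    using sum_superset_weight[of moment "{}"] k Ymat by (simp add: moment_def)
  have "x $ i = (\<Sum>U\<in>UNIV. ?z U *\<^sub>R ind U) $ i" for i
  proof -
    have "(\<Sum>U\<in>UNIV. ?z U *\<^sub>R ind U) $ i = (\<Sum>U | {i} \<subseteq> U. ?z U)"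
      unfolding sum_component by (rule sum.mono_neutral_cong_right) (auto simp: ind_def)
    also have "\<dots> = moment {i}" by (rule sum_superset_weight)
    also have "\<dots> = Y (ones {i}) cube01"
    \<comment> \<open>For \<open>k = 1\<close> the cut-off in \<open>moment\<close> already concerns singletons.\<close>
    proof (cases "k = 1")
      case True
      then have "Y (ones {i}) (ones {}) = 0"
        by (intro SA_plus_large_union_zero) auto
      with True moment_zero_superset[of "{i}" "{i}"] show ?thesis by simp
    next
      case False
      then show ?thesis using moment_matrix[of "{i}" "{}"] k by simp
    qed
    finally show ?thesis by (simp add: x_i)
  qed
  then have xz: "x = (\<Sum>U\<in>UNIV. ?z U *\<^sub>R ind U)" by (simp add: vec_eq_iff)
  have supp: "(\<Sum>U\<in>UNIV. f U) = (\<Sum>U | card U < k. f U)" if "\<And>U. ?z U = 0 \<Longrightarrow> f U = 0" 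
    for f :: "'n set \<Rightarrow> 'c::comm_monoid_add"
    using superset_weight_moment_large that by (intro sum.mono_neutral_right) (auto simp: not_less)
  have "(\<Sum>U | card U < k. ?z U *\<^sub>R ind U) \<in> convex hull (P \<inter> cube01)"
    using one supp[of ?z] all
    by (intro convex_sum convex_convex_hull superset_weight_moment_nonneg hull_inc)
      (auto simp: ind_in_cube)
  then show ?thesis
    unfolding xz integer_hull_def by (subst supp) auto
qed

end

lemma SA_plus_eq_integer_hull:
  fixes P :: "(real^'n::finite) set"
  assumes "convex P" "k > 0"
    and "\<And>x. x \<in> P \<Longrightarrow> card {i. x $ i = 1} < k"
    and "\<And>U. card U < k \<Longrightarrow> ind U \<in> P"
  shows "SA_plus k P = integer_hull P"
proof
  show "integer_hull P \<subseteq> SA_plus k P"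
    by (rule integer_hull_subset_SA_plus[OF assms(1)])
  show "SA_plus k P \<subseteq> integer_hull P"
    using SA_plus_point_in_hull[OF _ assms(3) _ assms(4)] assms(2) by (auto simp: SA_plus_def)
qed

section \<open>The sliced cube\<close>

lemma convex_P_rho: "convex (P_rho \<rho> :: (real^'n::finite) set)"
proof -
  have "P_rho \<rho> = cbox 0 (\<chi> i. 1) \<inter> {x :: real^'n. (\<chi> i. 1) \<bullet> x \<le> real CARD('n) - \<rho>}"
    by (auto simp: P_rho_def mem_box_cart inner_vec_def)
  then show ?thesis
    by (simp add: convex_Int convex_box convex_halfspace_le)
qed

lemma ones_sum_le:
  fixes x :: "real^'n::finite"
  assumes "\<And>i. 0 \<le> x $ i"
  shows "real (card {i. x $ i = 1}) \<le> (\<Sum>i\<in>UNIV. x $ i)"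
proof -
  have "real (card {i. x $ i = 1}) = (\<Sum>i | x $ i = 1. x $ i)" by simp
  also have "\<dots> \<le> (\<Sum>i\<in>UNIV. x $ i)" using assms by (intro sum_mono2) auto
  finally show ?thesis .
qed

theorem proposition4:
  fixes \<rho> :: real
  assumes "CARD('n::finite) \<ge> 2"
    and "0 < \<rho>" and "\<rho> < real CARD('n)" and "\<rho> \<notin> \<int>"
  shows "SA_plus_rank (P_rho \<rho> :: (real^'n) set) \<le> enat (nat (int CARD('n) - \<lceil>\<rho>\<rceil> + 1))"
proof -
  define k where "k = nat (int CARD('n) - \<lceil>\<rho>\<rceil> + 1)"
  have "\<lceil>\<rho>\<rceil> \<le> int CARD('n)" using assms by (simp add: ceiling_le_iff)
  then have k: "int k = int CARD('n) - \<lceil>\<rho>\<rceil> + 1" by (simp add: k_def)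
  \<comment> \<open>An integer is at most \<open>n - \<rho>\<close> exactly if it is at most \<open>n - \<lceil>\<rho>\<rceil> = k - 1\<close>.\<close>
  have less_k: "card U < k \<longleftrightarrow> real (card U) \<le> real CARD('n) - \<rho>" for U :: "'n set"
  proof -
    have "card U < k \<longleftrightarrow> \<lceil>\<rho>\<rceil> \<le> int CARD('n) - int (card U)" using k by linarith
    also have "\<dots> \<longleftrightarrow> real (card U) \<le> real CARD('n) - \<rho>" by (auto simp: ceiling_le_iff)
    finally show ?thesis .
  qed
  have "SA_plus k (P_rho \<rho> :: (real^'n) set) = integer_hull (P_rho \<rho>)"
  proof (rule SA_plus_eq_integer_hull[OF convex_P_rho])
    show "k > 0" using k \<open>\<lceil>\<rho>\<rceil> \<le> int CARD('n)\<close> by linarith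
    show "card {i. x $ i = 1} < k" if "x \<in> P_rho \<rho>" for x :: "real^'n"
      using that ones_sum_le[of x] unfolding less_k P_rho_def by fastforce
    show "ind U \<in> P_rho \<rho>" if "card U < k" for U :: "'n set"
    proof -
      have "(\<Sum>i\<in>UNIV. ind U $ i) = real (card U)"
        by (simp add: ind_def flip: sum.inter_filter)
      with that show ?thesis unfolding less_k P_rho_def by (auto simp: ind_def)
    qed
  qed
  then show ?thesis
    unfolding SA_plus_rank_le_iff k_def by blast
qed

end
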